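(* Let $\mathfrak g$ be an $8$-dimensional real nilpotent Lie algebra with a 1-abelian complex structure $J_M$ of maximal type defined by a singular non-Hermitian matrix $M\in M_3(\mathbb C)$. Then there exists a basis $\{\sigma^i\}_{i=1}^4$ of $\mathfrak g^{1,0}$ such that $d\sigma^1=d\sigma^2=d\sigma^3=0$ and one of the following holds: (i) $J^4_{s1}$: $d\sigma^4=\sigma^{1\bar 2}+\sigma^{2\bar 3}$; (ii) $J^4_{s2}$: $d\sigma^4=\sigma^{1\bar 1}+\sigma^{2\bar 3}$.
   Context: For a complex structure $J$ on a real Lie algebra $\mathfrak g$, $\mathfrak g^{1,0}\subset\mathfrak g^*_{\mathbb C}$ is the space of $(1,0)$-forms and $d$ is the Chevalley–Eilenberg differential. We write $\sigma^{j\bar k}=\sigma^j\wedge\overline{\sigma^k}$. $J$ is abelian if $[Jx,Jy]=[x,y]$ for all $x,y$. An abelian complex structure on a $2n$-dimensional nilpotent Lie algebra is 1-abelian if $h^{1,0}=\dim\ker(\bar\partial:\mathfrak g^{1,0}\to\bigwedge^{1,1}\mathfrak g^* )$ equals $n-1$. For every 1-abelian complex structure there are a basis $\{\omega^i\}_{i=1}^n$ of $\mathfrak g^{1,0}$ and a nonzero $M\in M_{n-1}(\mathbb C)$ with $d\omega^1=\dots=d\omega^{n-1}=0$ and $d\omega^n=\sum_{j,k=1}^{n-1}M_{jk}\,\omega^{j\bar k}$; the structure is then denoted $J_M$. Maximal type. Let $M$ be a singular $k\times k$ complex matrix and $m_1=k-\mathrm{rank}(M)$. Choose an invertible $S$ such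 that the last $m_1$ rows of $SM$ vanish, and write $SMS^*=\begin{pmatrix}M'&N\\0&0_{m_1}\end{pmatrix}$ with $M'$ of size $k-m_1$ ($S^*$ is the conjugate transpose); put $m_2=\mathrm{rank}(N)$ (independent of $S$). $J_M$ (or $M$) is of maximal type if $m_1=m_2$. *)

theory Defs
  imports
    "HOL-Analysis.Linear_Algebra"
    "HOL-Library.Function_Algebras"
    "Jordan_Normal_Form.Schur_Decomposition"
    "Jordan_Normal_Form.DL_Rank"
begin

text \<open>Real Lie algebras are carried by a type of class \<open>real_vector\<close>; the bracket is an explicit
  parameter.\<close>

definition lie_bracket :: "('a::real_vector \<Rightarrow> 'a \<Rightarrow> 'a) \<Rightarrow> bool" where
  "lie_bracket br \<longleftrightarrow> bilinear br \<and> (\<forall>x. br x x = 0) \<and>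
     (\<forall>x y z. br x (br y z) + br y (br z x) + br z (br x y) = 0)"

primrec lower_central :: "('a::real_vector \<Rightarrow> 'a \<Rightarrow> 'a) \<Rightarrow> nat \<Rightarrow> 'a set" where
  "lower_central br 0 = UNIV"
| "lower_central br (Suc k) = Real_Vector_Spaces.span {br x y | x y. y \<in> lower_central br k}"

definition nilpotent_lie_algebra :: "('a::real_vector \<Rightarrow> 'a \<Rightarrow> 'a) \<Rightarrow> bool" where
  "nilpotent_lie_algebra br \<longleftrightarrow> lie_bracket br \<and> (\<exists>k. lower_central br k = {0})"

definition complex_structure :: "('a::real_vector \<Rightarrow> 'a \<Rightarrow> 'a) \<Rightarrow> ('a \<Rightarrow> 'a) \<Rightarrow> bool" where
  "complex_structure br J \<longleftrightarrow> linear J \<and> (\<forall>x. J (J x) = - x) \<and>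
     (\<forall>x y. br (J x) (J y) - J (br (J x) y) - J (br x (J y)) - br x y = 0)"

definition abelian_complex_structure :: "('a::real_vector \<Rightarrow> 'a \<Rightarrow> 'a) \<Rightarrow> ('a \<Rightarrow> 'a) \<Rightarrow> bool" where
  "abelian_complex_structure br J \<longleftrightarrow>
     complex_structure br J \<and> (\<forall>x y. br (J x) (J y) = br x y)"

text \<open>A complex-valued 1-form is a real-linear function \<open>'a \<Rightarrow> complex\<close>, a 2-form an (alternating,
  real-bilinear) function \<open>'a \<times> 'a \<Rightarrow> complex\<close>. Forms are added pointwise
  (\<open>Function_Algebras\<close>); the complex scalars also act pointwise.\<close>

definition form_scale :: "complex \<Rightarrow> ('x \<Rightarrow> complex) \<Rightarrow> 'x \<Rightarrow> complex" where
  "form_scale c f = (\<lambda>x. c * f x)"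

interpretation form: vector_space form_scale
  by unfold_locales (auto simp: form_scale_def fun_eq_iff algebra_simps)

definition cnj_form :: "('x \<Rightarrow> complex) \<Rightarrow> 'x \<Rightarrow> complex" where
  "cnj_form f = (\<lambda>x. cnj (f x))"

definition wedge :: "('a \<Rightarrow> complex) \<Rightarrow> ('a \<Rightarrow> complex) \<Rightarrow> 'a \<times> 'a \<Rightarrow> complex" where
  "wedge f g = (\<lambda>(x, y). f x * g y - f y * g x)"

definition ce_d :: "('a \<Rightarrow> 'a \<Rightarrow> 'a) \<Rightarrow> ('a \<Rightarrow> complex) \<Rightarrow> 'a \<times> 'a \<Rightarrow> complex" where
  "ce_d br f = (\<lambda>(x, y). - f (br x y))"

definition forms10 :: "('a::real_vector \<Rightarrow> 'a) \<Rightarrow> ('a \<Rightarrow> complex) set" where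
  "forms10 J = {f. linear f \<and> (\<forall>x. f (J x) = \<i> * f x)}"

definition forms20 :: "('a::real_vector \<Rightarrow> 'a) \<Rightarrow> ('a \<times> 'a \<Rightarrow> complex) set" where
  "forms20 J = form.span {wedge f g | f g. f \<in> forms10 J \<and> g \<in> forms10 J}"

definition forms11 :: "('a::real_vector \<Rightarrow> 'a) \<Rightarrow> ('a \<times> 'a \<Rightarrow> complex) set" where
  "forms11 J = form.span {wedge f (cnj_form g) | f g. f \<in> forms10 J \<and> g \<in> forms10 J}"

definition forms02 :: "('a::real_vector \<Rightarrow> 'a) \<Rightarrow> ('a \<times> 'a \<Rightarrow> complex) set" where
  "forms02 J = form.span {wedge (cnj_form f) (cnj_form g) | f g. f \<in> forms10 J \<and> g \<in> forms10 J}"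

text \<open>On (1,0)-forms, \<open>dbar\<close> is the (1,1)-component of the differential with respect to the
  (direct) decomposition of the complex 2-forms into types (2,0), (1,1) and (0,2).\<close>

definition dbar ::
  "('a::real_vector \<Rightarrow> 'a \<Rightarrow> 'a) \<Rightarrow> ('a \<Rightarrow> 'a) \<Rightarrow> ('a \<Rightarrow> complex) \<Rightarrow> 'a \<times> 'a \<Rightarrow> complex" where
  "dbar br J f = (THE v. v \<in> forms11 J \<and>
     (\<exists>u \<in> forms20 J. \<exists>w \<in> forms02 J. ce_d br f = u + v + w))"

definition h10 :: "('a::real_vector \<Rightarrow> 'a \<Rightarrow> 'a) \<Rightarrow> ('a \<Rightarrow> 'a) \<Rightarrow> nat" where
  "h10 br J = form.dim {f \<in> forms10 J. dbar br J f = 0}"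

definition one_abelian :: "nat \<Rightarrow> ('a::real_vector \<Rightarrow> 'a \<Rightarrow> 'a) \<Rightarrow> ('a \<Rightarrow> 'a) \<Rightarrow> bool" where
  "one_abelian n br J \<longleftrightarrow>
     real_vector.dim (UNIV :: 'a set) = 2 * n \<and> nilpotent_lie_algebra br \<and>
     abelian_complex_structure br J \<and> h10 br J + 1 = n"

definition basis10 :: "nat \<Rightarrow> ('a::real_vector \<Rightarrow> 'a) \<Rightarrow> (nat \<Rightarrow> 'a \<Rightarrow> complex) \<Rightarrow> bool" where
  "basis10 n J \<omega> \<longleftrightarrow> inj_on \<omega> {1..n} \<and> form.independent (\<omega> ` {1..n}) \<and>
     form.span (\<omega> ` {1..n}) = forms10 J"

text \<open>\<open>J\<close> is the 1-abelian structure \<open>J_M\<close>. Forms are numbered from 1, as usual, but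
  matrix entries from 0.\<close>

definition is_J_M :: "nat \<Rightarrow> ('a::real_vector \<Rightarrow> 'a \<Rightarrow> 'a) \<Rightarrow> ('a \<Rightarrow> 'a) \<Rightarrow> complex mat \<Rightarrow> bool" where
  "is_J_M n br J M \<longleftrightarrow> one_abelian n br J \<and>
     M \<in> carrier_mat (n - 1) (n - 1) \<and> M \<noteq> 0\<^sub>m (n - 1) (n - 1) \<and>
     (\<exists>\<omega>. basis10 n J \<omega> \<and> (\<forall>i \<in> {1..n - 1}. ce_d br (\<omega> i) = 0) \<and>
       ce_d br (\<omega> n) =
         (\<Sum>j = 1..n - 1. \<Sum>k = 1..n - 1.
            form_scale (M $$ (j - 1, k - 1)) (wedge (\<omega> j) (cnj_form (\<omega> k)))))"

text \<open>\<open>vec_space.rank r A\<close> is the rank (dimension of the column space) of a matrix \<open>A\<close>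
  with \<open>r\<close> rows. Blocks with no rows or no columns are allowed.\<close>

definition corank :: "nat \<Rightarrow> complex mat \<Rightarrow> nat" where
  "corank k M = k - vec_space.rank k M"

text \<open>\<open>has_m2 k M m\<close>: some admissible choice of \<open>S\<close> yields a block \<open>N\<close> of rank \<open>m\<close>. Such an
  \<open>S\<close> always exists and the rank of \<open>N\<close> does not depend on it, so \<open>m\<close> is a function of \<open>M\<close>.\<close>

definition has_m2 :: "nat \<Rightarrow> complex mat \<Rightarrow> nat \<Rightarrow> bool" where
  "has_m2 k M m \<longleftrightarrow>
     (let m1 = corank k M; r = k - m1 in
      \<exists>S M' N. S \<in> carrier_mat k k \<and> invertible_mat S \<and>
        (\<forall>i \<in> {r..<k}. row (S * M) i = 0\<^sub>v k) \<and>
        M' \<in> carrier_mat r r \<and> N \<in> carrier_mat r m1 \<and>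
        S * M * mat_adjoint S = four_block_mat M' N (0\<^sub>m m1 r) (0\<^sub>m m1 m1) \<and>
        m = vec_space.rank r N)"

definition maximal_type :: "nat \<Rightarrow> complex mat \<Rightarrow> bool" where
  "maximal_type k M \<longleftrightarrow> M \<in> carrier_mat k k \<and> \<not> invertible_mat M \<and> has_m2 k M (corank k M)"

end

theory Submission
  imports Defs
begin

text \<open>The differential of the last form of an adapted basis is a sesquilinear expression in the
  remaining \<open>m\<close> closed forms, and passing to other closed forms changes its matrix \<open>M\<close> by a
  congruence \<open>S M S*\<close> (\<open>adapted_basis_congruence\<close>). So the theorem is about a \<open>3 \<times> 3\<close> matrix up to
  congruence and a scalar.

  Maximal type pins down the shape of \<open>M\<close>. With \<open>m\<^sub>1\<close> the corank, the block \<open>N\<close> has \<open>3 - m\<^sub>1\<close> rows,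
  and its rank has to be \<open>m\<^sub>1\<close>; as \<open>M\<close> is singular, this leaves \<open>m\<^sub>1 = 1\<close>. Hence \<open>S M S*\<close> has a
  vanishing last row and a non-zero last column, and its first two rows are linearly independent
  because the rank is two (\<open>maximal_type_3_shape\<close>). The differential is therefore
  \<open>\<tau>\<^sub>1 \<and> cnj \<phi> + \<tau>\<^sub>2 \<and> cnj \<psi>\<close>, where one of \<open>\<phi>\<close>, \<open>\<psi>\<close>, say \<open>\<psi>\<close>, involves \<open>\<tau>\<^sub>3\<close>. Then \<open>\<psi>\<close> can
  replace \<open>\<tau>\<^sub>3\<close> in the basis, and a multiple of \<open>\<tau>\<^sub>1\<close> added to \<open>\<tau>\<^sub>2\<close> absorbs the \<open>\<psi>\<close>-part of \<open>\<phi>\<close>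
  (\<open>reduce_two_summands\<close>), which leaves \<open>\<tau>\<^sub>1 \<and> cnj (a \<tau>\<^sub>1 + b \<tau>\<^sub>2) + \<tau>\<^sub>2 \<and> cnj \<tau>\<^sub>3\<close> with
  \<open>(a, b) \<noteq> (0, 0)\<close>. The first structure arises if \<open>a = 0\<close>, the second one if \<open>a \<noteq> 0\<close>
  (\<open>reduce_first_summand\<close>).\<close>

section \<open>Changing a basis of (1,0)-forms\<close>

lemma ce_d_form_scale: "ce_d br (form_scale c f) = form_scale c (ce_d br f)"
  by (auto simp: ce_d_def form_scale_def fun_eq_iff)

lemma ce_d_span_eq_0:
  assumes "f \<in> form.span S" and "\<And>g. g \<in> S \<Longrightarrow> ce_d br g = 0"
  shows "ce_d br f = 0"
proof -
  have "form.subspace {g. ce_d br g = 0}"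
    unfolding form.subspace_def
    by (auto simp: ce_d_def form_scale_def fun_eq_iff)
  then show ?thesis
    using form.span_minimal[of S "{g. ce_d br g = 0}"] assms by auto
qed

lemma sum_form_apply: "(\<Sum>i\<in>A. f i) x = (\<Sum>i\<in>A. (f i x :: complex))"
  by (induction A rule: infinite_finite_induct) auto

text \<open>A linear relation or a repetition among the \<open>\<sigma>\<^sub>i\<close> would give a generating set with fewer than \<open>n\<close>
  elements, so it is enough that they generate.\<close>

lemma basis10_change:
  assumes \<omega>: "basis10 n J \<omega>"
    and \<sigma>: "\<And>i. i \<in> {1..n} \<Longrightarrow> \<sigma> i \<in> form.span (\<omega> ` {1..n})"
    and gen: "\<And>i. i \<in> {1..n} \<Longrightarrow> \<omega> i \<in> form.span (\<sigma> ` {1..n})"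
  shows "basis10 n J \<sigma>"
proof -
  let ?W = "\<omega> ` {1..n}" and ?S = "\<sigma> ` {1..n}"
  have ind: "form.independent ?W" and cW: "card ?W = n" and sW: "form.span ?W = forms10 J"
    using \<omega> by (auto simp: basis10_def card_image)
  have span: "form.span ?S = form.span ?W"
    using \<sigma> gen by (auto simp: form.span_eq)
  have few: "n \<le> card B" if "finite B" "?W \<subseteq> form.span B" for B
    using form.independent_span_bound[OF that(1) ind that(2)] cW by simp
  have cS: "card ?S = n"
    using few[of ?S] gen card_image_le[of "{1..n}" \<sigma>] by fastforce
  have "form.independent ?S"
  proof
    assume "form.dependent ?S"
    then obtain a where a: "a \<in> ?S" "a \<in> form.span (?S - {a})"
      by (auto simp: form.dependent_def)
    then have "form.span (?S - {a}) = form.span ?S"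
      using form.span_redundant[OF a(2)] by (simp add: insert_absorb)
    then have "n \<le> card (?S - {a})"
      using few[of "?S - {a}"] span form.span_superset[of ?W] by auto
    then show False
      using a(1) cS by (metis card_Diff1_less finite_atLeastAtMost finite_imageI leD)
  qed
  moreover have "inj_on \<sigma> {1..n}"
    using cS by (intro eq_card_imp_inj_on) auto
  ultimately show ?thesis
    using span sW by (simp add: basis10_def)
qed

text \<open>The number \<open>m\<close> counts the closed forms, so that the whole basis has \<open>m + 1\<close> elements and the
  indices agree with the size of the matrix that describes \<open>\<beta>\<close>.\<close>

definition adapted_basis ::
  "nat \<Rightarrow> ('a::real_vector \<Rightarrow> 'a \<Rightarrow> 'a) \<Rightarrow> ('a \<Rightarrow> 'a) \<Rightarrow> (nat \<Rightarrow> 'a \<Rightarrow> complex) \<Rightarrow>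
     ('a \<times> 'a \<Rightarrow> complex) \<Rightarrow> bool" where
  "adapted_basis m br J \<tau> \<beta> \<longleftrightarrow> basis10 (Suc m) J \<tau> \<and> (\<forall>i \<in> {1..m}. ce_d br (\<tau> i) = 0) \<and>
     ce_d br (\<tau> (Suc m)) = \<beta>"

lemma adapted_basis_change:
  assumes \<tau>: "adapted_basis m br J \<tau> \<beta>"
    and \<sigma>: "\<And>i. i \<in> {1..m} \<Longrightarrow> \<sigma> i \<in> form.span (\<tau> ` {1..m})"
    and gen: "\<And>i. i \<in> {1..m} \<Longrightarrow> \<tau> i \<in> form.span (\<sigma> ` {1..m})"
    and last: "\<sigma> (Suc m) = form_scale c (\<tau> (Suc m))" "c \<noteq> 0"
  shows "adapted_basis m br J \<sigma> (form_scale c \<beta>)"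
proof -
  have up: "form.span (f ` {1..m}) \<subseteq> form.span (f ` {1..Suc m})" for f :: "nat \<Rightarrow> 'a \<Rightarrow> complex"
    by (intro form.span_mono image_mono) auto
  have "basis10 (Suc m) J \<sigma>"
  proof (rule basis10_change[of _ _ \<tau>])
    show "basis10 (Suc m) J \<tau>"
      using \<tau> by (simp add: adapted_basis_def)
  next
    fix i assume i: "i \<in> {1..Suc m}"
    have "form_scale c (\<tau> (Suc m)) \<in> form.span (\<tau> ` {1..Suc m})"
      by (intro form.span_scale form.span_base) auto
    then show "\<sigma> i \<in> form.span (\<tau> ` {1..Suc m})"
      using i \<sigma> up[of \<tau>] last by (cases "i = Suc m") auto
    have "\<tau> (Suc m) = form_scale (inverse c) (\<sigma> (Suc m))"
      using last by (simp add: form_scale_def fun_eq_iff)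
    then have "\<tau> (Suc m) \<in> form.span (\<sigma> ` {1..Suc m})"
      by (simp only:) (intro form.span_scale form.span_base, auto)
    then show "\<tau> i \<in> form.span (\<sigma> ` {1..Suc m})"
      using i gen up[of \<sigma>] by (cases "i = Suc m") auto
  qed
  moreover have "ce_d br (\<sigma> i) = 0" if "i \<in> {1..m}" for i
    using \<tau> by (intro ce_d_span_eq_0[OF \<sigma>[OF that]]) (auto simp: adapted_basis_def)
  ultimately show ?thesis
    using \<tau> last by (simp add: adapted_basis_def ce_d_form_scale)
qed

section \<open>Congruent matrices\<close>

definition sesqui_form ::
  "nat \<Rightarrow> complex mat \<Rightarrow> (nat \<Rightarrow> 'a \<Rightarrow> complex) \<Rightarrow> 'a \<times> 'a \<Rightarrow> complex" where
  "sesqui_form m M \<omega> = (\<Sum>j = 1..m. \<Sum>k = 1..m.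
     form_scale (M $$ (j - 1, k - 1)) (wedge (\<omega> j) (cnj_form (\<omega> k))))"

lemma mat_adjoint_carrier: "A \<in> carrier_mat n m \<Longrightarrow> mat_adjoint A \<in> carrier_mat m n"
  for A :: "complex mat"
  by (auto simp: mat_adjoint_def mat_of_rows_def)

lemma mat_adjoint_index:
  "i < dim_col A \<Longrightarrow> j < dim_row A \<Longrightarrow> mat_adjoint A $$ (i, j) = cnj (A $$ (j, i))"
  by (auto simp: mat_adjoint_def mat_of_rows_def)

text \<open>Summation from 1 matches the numbering of the forms.\<close>

lemma index_mult_mat_from_1:
  assumes "A \<in> carrier_mat n m" "B \<in> carrier_mat m l" "1 \<le> i" "i \<le> n" "1 \<le> j" "j \<le> l"
  shows "(A * B) $$ (i - 1, j - 1) =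
    (\<Sum>k = 1..m. A $$ (i - 1, k - 1) * B $$ (k - 1, j - 1))"
  using assms by (auto simp: scalar_prod_def sum.atLeast1_atMost_eq lessThan_atLeast0)

lemma mat_adjoint_mult:
  fixes A B :: "complex mat"
  assumes "A \<in> carrier_mat n m" "B \<in> carrier_mat m l"
  shows "mat_adjoint (A * B) = mat_adjoint B * mat_adjoint A"
  using assms mat_adjoint_carrier[OF assms(1)] mat_adjoint_carrier[OF assms(2)]
    mat_adjoint_carrier[OF mult_carrier_mat[OF assms]]
  by (intro eq_matI) (auto simp: mat_adjoint_index scalar_prod_def mult.commute)

lemma mat_adjoint_one: "mat_adjoint (1\<^sub>m n :: complex mat) = 1\<^sub>m n"
  using mat_adjoint_carrier[of "1\<^sub>m n" n n]
  by (intro eq_matI) (auto simp: mat_adjoint_index)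

text \<open>Substituting \<open>\<omega>\<^sub>i = \<Sum>\<^sub>a S\<^sub>a\<^sub>i \<tau>\<^sub>a\<close> and collecting the coefficient of \<open>\<tau>\<^sub>a \<and> cnj \<tau>\<^sub>b\<close> produces
  the entry of \<open>S M S*\<close>; the second factor is conjugated, which is why \<open>S*\<close> appears and not the
  transpose.\<close>

lemma sesqui_form_congruence:
  fixes M S :: "complex mat"
  assumes M: "M \<in> carrier_mat m m" and S: "S \<in> carrier_mat m m"
    and \<omega>: "\<And>i. i \<in> {1..m} \<Longrightarrow> \<omega> i = (\<Sum>a = 1..m. form_scale (S $$ (a - 1, i - 1)) (\<tau> a))"
  shows "sesqui_form m M \<omega> = sesqui_form m (S * M * mat_adjoint S) \<tau>"
proof -
  let ?X = "S * M * mat_adjoint S"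
  have X: "?X $$ (a - 1, b - 1) =
      (\<Sum>k = 1..m. \<Sum>j = 1..m. S $$ (a - 1, j - 1) * M $$ (j - 1, k - 1) * cnj (S $$ (b - 1, k - 1)))"
    if "a \<in> {1..m}" "b \<in> {1..m}" for a b
  proof -
    have "?X $$ (a - 1, b - 1) =
        (\<Sum>k = 1..m. (S * M) $$ (a - 1, k - 1) * mat_adjoint S $$ (k - 1, b - 1))"
      using that by (intro index_mult_mat_from_1[OF mult_carrier_mat[OF S M] mat_adjoint_carrier[OF S]]) auto
    also have "\<dots> = (\<Sum>k = 1..m. (\<Sum>j = 1..m. S $$ (a - 1, j - 1) * M $$ (j - 1, k - 1)) *
        cnj (S $$ (b - 1, k - 1)))"
    proof (intro sum.cong refl arg_cong2[where f = "(*)"])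
      fix k assume k: "k \<in> {1..m}"
      show "(S * M) $$ (a - 1, k - 1) = (\<Sum>j = 1..m. S $$ (a - 1, j - 1) * M $$ (j - 1, k - 1))"
        using that k by (intro index_mult_mat_from_1[OF S M]) auto
      show "mat_adjoint S $$ (k - 1, b - 1) = cnj (S $$ (b - 1, k - 1))"
        using that k S by (intro mat_adjoint_index) auto
    qed
    finally show ?thesis
      by (simp only: sum_distrib_right)
  qed
  have key: "(\<Sum>j = 1..m. \<Sum>k = 1..m. M $$ (j - 1, k - 1) * (\<omega> j x * cnj (\<omega> k y))) =
      (\<Sum>a = 1..m. \<Sum>b = 1..m. ?X $$ (a - 1, b - 1) * (\<tau> a x * cnj (\<tau> b y)))" for x y
  proof -
    let ?t = "\<lambda>j k a b. M $$ (j - 1, k - 1) * S $$ (a - 1, j - 1) * cnj (S $$ (b - 1, k - 1)) *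
      \<tau> a x * cnj (\<tau> b y)"
    have "(\<Sum>j = 1..m. \<Sum>k = 1..m. M $$ (j - 1, k - 1) * (\<omega> j x * cnj (\<omega> k y))) =
        (\<Sum>j = 1..m. \<Sum>k = 1..m. \<Sum>a = 1..m. \<Sum>b = 1..m. ?t j k a b)"
      by (intro sum.cong refl)
        (simp add: \<omega> sum_form_apply form_scale_def sum_product sum_distrib_left mult_ac,
          rule sum.swap)
    also have "\<dots> = (\<Sum>j = 1..m. \<Sum>a = 1..m. \<Sum>k = 1..m. \<Sum>b = 1..m. ?t j k a b)"
      by (intro sum.cong refl sum.swap)
    also have "\<dots> = (\<Sum>a = 1..m. \<Sum>j = 1..m. \<Sum>k = 1..m. \<Sum>b = 1..m. ?t j k a b)"
      by (rule sum.swap)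
    also have "\<dots> = (\<Sum>a = 1..m. \<Sum>j = 1..m. \<Sum>b = 1..m. \<Sum>k = 1..m. ?t j k a b)"
      by (intro sum.cong refl sum.swap)
    also have "\<dots> = (\<Sum>a = 1..m. \<Sum>b = 1..m. \<Sum>j = 1..m. \<Sum>k = 1..m. ?t j k a b)"
      by (intro sum.cong refl sum.swap)
    also have "\<dots> = (\<Sum>a = 1..m. \<Sum>b = 1..m. \<Sum>k = 1..m. \<Sum>j = 1..m. ?t j k a b)"
      by (intro sum.cong refl sum.swap)
    also have "\<dots> = (\<Sum>a = 1..m. \<Sum>b = 1..m. ?X $$ (a - 1, b - 1) * (\<tau> a x * cnj (\<tau> b y)))"
      by (intro sum.cong refl) (simp only: X sum_distrib_left sum_distrib_right mult_ac)
    finally show ?thesis .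
  qed
  \<comment> \<open>Each wedge product is the antisymmetrisation of a product of two forms, so the identity for
    products, used in both orders of the arguments, is enough.\<close>
  have split: "sesqui_form m A \<eta> (x, y) =
      (\<Sum>j = 1..m. \<Sum>k = 1..m. A $$ (j - 1, k - 1) * (\<eta> j x * cnj (\<eta> k y))) -
      (\<Sum>j = 1..m. \<Sum>k = 1..m. A $$ (j - 1, k - 1) * (\<eta> j y * cnj (\<eta> k x)))"
    for A \<eta> and x y :: 'a
    by (simp add: sesqui_form_def sum_form_apply form_scale_def wedge_def cnj_form_def
        sum_subtractf right_diff_distrib)
  show ?thesis
    by (auto simp: fun_eq_iff split key simp del: One_nat_def)
qed

text \<open>The closed forms \<open>\<tau>\<close> that realise the congruence by \<open>S\<close> are the combinations of the \<open>\<omega>\<^sub>i\<close> with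
  the coefficients of the inverse of \<open>S\<close>.\<close>

lemma adapted_basis_congruence:
  fixes M S :: "complex mat"
  assumes M: "M \<in> carrier_mat m m" and S: "S \<in> carrier_mat m m" and inv: "invertible_mat S"
    and \<omega>: "adapted_basis m br J \<omega> (sesqui_form m M \<omega>)"
  shows "\<exists>\<tau>. adapted_basis m br J \<tau> (sesqui_form m (S * M * mat_adjoint S) \<tau>)"
proof -
  obtain T where "S * T = 1\<^sub>m m" and "T * S = 1\<^sub>m (dim_row T)"
    using inv S by (auto simp: invertible_mat_def inverts_mat_def)
  then have T: "T \<in> carrier_mat m m"
    using S by (metis carrier_matD(2) carrier_matI index_mult_mat(3) index_one_mat(3))
  with \<open>T * S = _\<close> have TS: "T * S = 1\<^sub>m m" by simp
  define \<tau> where "\<tau> a = (if a = Suc m then form_scale 1 (\<omega> a)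
    else (\<Sum>i = 1..m. form_scale (T $$ (i - 1, a - 1)) (\<omega> i)))" for a
  have expand: "\<omega> i = (\<Sum>a = 1..m. form_scale (S $$ (a - 1, i - 1)) (\<tau> a))"
    if i: "i \<in> {1..m}" for i
  proof
    fix x
    have "(\<Sum>a = 1..m. form_scale (S $$ (a - 1, i - 1)) (\<tau> a)) x =
        (\<Sum>a = 1..m. \<Sum>l = 1..m. T $$ (l - 1, a - 1) * S $$ (a - 1, i - 1) * \<omega> l x)"
      by (auto simp: sum_form_apply form_scale_def \<tau>_def sum_distrib_left mult_ac intro!: sum.cong)
    also have "\<dots> = (\<Sum>l = 1..m. (\<Sum>a = 1..m. T $$ (l - 1, a - 1) * S $$ (a - 1, i - 1)) * \<omega> l x)"
      by (subst sum.swap) (simp add: sum_distrib_right)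
    also have "\<dots> = (\<Sum>l = 1..m. (T * S) $$ (l - 1, i - 1) * \<omega> l x)"
      using i by (intro sum.cong refl arg_cong2[where f = "(*)"] index_mult_mat_from_1[OF T S, symmetric]) auto
    also have "\<dots> = (\<Sum>l = 1..m. if l = i then \<omega> l x else 0)"
      using i by (intro sum.cong refl) (auto simp: TS)
    also have "\<dots> = \<omega> i x"
      using i by simp
    finally show "\<omega> i x = (\<Sum>a = 1..m. form_scale (S $$ (a - 1, i - 1)) (\<tau> a)) x" ..
  qed
  have "adapted_basis m br J \<tau> (form_scale 1 (sesqui_form m M \<omega>))"
  proof (rule adapted_basis_change[OF \<omega>])
    fix i assume i: "i \<in> {1..m}"
    then have "\<tau> i = (\<Sum>l = 1..m. form_scale (T $$ (l - 1, i - 1)) (\<omega> l))"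
      by (simp add: \<tau>_def)
    then show "\<tau> i \<in> form.span (\<omega> ` {1..m})"
      by (simp only:) (intro form.span_sum form.span_scale form.span_base imageI)
    show "\<omega> i \<in> form.span (\<tau> ` {1..m})"
      by (subst expand[OF i]) (intro form.span_sum form.span_scale form.span_base imageI)
  qed (simp_all add: \<tau>_def)
  then show ?thesis
    using sesqui_form_congruence[OF M S expand] by auto
qed

section \<open>What maximal type means for a singular matrix of size three\<close>

text \<open>A product with a matrix \<open>u v\<^sup>T\<close> in the middle is \<open>(A u) (v\<^sup>T B)\<close>.\<close>

lemma rank_mult_rank_one_le_1:
  fixes A B X :: "complex mat"
  assumes A: "A \<in> carrier_mat n n" and B: "B \<in> carrier_mat n n" and X: "X \<in> carrier_mat n n"
    and uv: "\<And>a b. a < n \<Longrightarrow> b < n \<Longrightarrow> X $$ (a, b) = u a * v b"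
  shows "vec_space.rank n (A * X * B) \<le> 1"
proof (rule vec_space.rank_le_1_product_entries[where
      f = "\<lambda>i. \<Sum>a = 0..<n. A $$ (i, a) * u a" and g = "\<lambda>j. \<Sum>b = 0..<n. v b * B $$ (b, j)"])
  show "A * X * B \<in> carrier_mat n n"
    using A B X by simp
  fix i j assume "i < dim_row (A * X * B)" "j < dim_col (A * X * B)"
  then show "(A * X * B) $$ (i, j) =
      (\<Sum>a = 0..<n. A $$ (i, a) * u a) * (\<Sum>b = 0..<n. v b * B $$ (b, j))"
    using A B X by (simp add: scalar_prod_def uv sum_distrib_right sum_distrib_left mult_ac)
      (rule sum.swap)
qed

lemma corank_pos:
  fixes M :: "complex mat"
  assumes M: "M \<in> carrier_mat n n" and "\<not> invertible_mat M"
  shows "corank n M > 0"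
proof -
  have "det M = 0"
  proof (rule ccontr)
    assume "det M \<noteq> 0"
    then obtain B where "B \<in> carrier_mat n n" "B * M = 1\<^sub>m n" "M * B = 1\<^sub>m n"
      using det_non_zero_imp_unit[OF M] by (auto simp: Units_def ring_mat_simps)
    then show False
      using M assms(2) by (auto simp: invertible_mat_def inverts_mat_def)
  qed
  then show ?thesis
    using vec_space.det_zero_low_rank[OF M] by (simp add: corank_def)
qed

text \<open>The last conclusion is the form in which the rank enters the reduction: the first two rows are
  independent, and this is already visible in a minor that uses the last column. If both of these
  minors vanished, one of the first two rows would be a multiple of the other, because the last
  column is non-zero; then \<open>S M S*\<close>, and with it \<open>M\<close>, would have rank at most one.\<close>

lemma maximal_type_3_shape:
  assumes max: "maximal_type 3 M"
  obtains S where "S \<in> carrier_mat 3 3" and "invertible_mat S"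
    and "\<And>j. j < 3 \<Longrightarrow> (S * M * mat_adjoint S) $$ (2, j) = 0"
    and "\<exists>j < 2. (S * M * mat_adjoint S) $$ (0, j) * (S * M * mat_adjoint S) $$ (1, 2) \<noteq>
           (S * M * mat_adjoint S) $$ (1, j) * (S * M * mat_adjoint S) $$ (0, 2)"
proof -
  have M: "M \<in> carrier_mat 3 3" and sing: "\<not> invertible_mat M" and m2: "has_m2 3 M (corank 3 M)"
    using max by (auto simp: maximal_type_def)
  define m r where "m = corank 3 M" and "r = 3 - m"
  obtain S M' N where S: "S \<in> carrier_mat 3 3" "invertible_mat S"
    and N: "M' \<in> carrier_mat r r" "N \<in> carrier_mat r m"
    and X: "S * M * mat_adjoint S = four_block_mat M' N (0\<^sub>m m r) (0\<^sub>m m m)"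
    and rk: "m = vec_space.rank r N"
    using m2 by (auto simp: has_m2_def Let_def m_def r_def)
  have "m > 0"
    using corank_pos[OF M sing] by (simp add: m_def)
  obtain T where ST: "S * T = 1\<^sub>m 3" and TS': "T * S = 1\<^sub>m (dim_row T)"
    using S by (auto simp: invertible_mat_def inverts_mat_def)
  then have T: "T \<in> carrier_mat 3 3"
    using S by (metis carrier_matD(2) carrier_matI index_mult_mat(3) index_one_mat(3))
  with TS' have TS: "T * S = 1\<^sub>m 3" by simp
  note adj = mat_adjoint_carrier[OF S(1)] mat_adjoint_carrier[OF T]
  let ?X = "S * M * mat_adjoint S"
  have Xc: "?X \<in> carrier_mat 3 3"
    using S M adj by simp
  have "T * ?X * mat_adjoint T = T * S * M * (mat_adjoint S * mat_adjoint T)"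
    using S M T adj by (simp add: assoc_mult_mat[of _ 3 3 _ 3 _ 3])
  also have "mat_adjoint S * mat_adjoint T = 1\<^sub>m 3"
    by (simp add: mat_adjoint_mult[OF T S(1), symmetric] TS mat_adjoint_one)
  finally have M_eq: "M = T * ?X * mat_adjoint T"
    using M by (simp add: TS)
  \<comment> \<open>A corank above one leaves at most one row for \<open>N\<close>, whose rank is then too small.\<close>
  have "m = 1"
  proof (rule ccontr)
    assume "m \<noteq> 1"
    with \<open>m > 0\<close> have "r \<le> 1"
      by (simp add: r_def)
    have "vec_space.rank r N \<le> 1"
    proof (rule vec_space.rank_le_1_product_entries[where f = "\<lambda>_. 1" and g = "\<lambda>c. N $$ (0, c)"])
      fix i c assume "i < dim_row N"
      with N \<open>r \<le> 1\<close> have "i = 0" by simp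
      then show "N $$ (i, c) = 1 * N $$ (0, c)" by simp
    qed (fact N)
    then show False
      using rk \<open>m > 0\<close> \<open>m \<noteq> 1\<close> by simp
  qed
  then have "r = 2" by (simp add: r_def)
  have row2: "?X $$ (2, j) = 0" if "j < 3" for j
    using that N \<open>m = 1\<close> \<open>r = 2\<close> by (auto simp: X)
  have last_col: "?X $$ (0, 2) \<noteq> 0 \<or> ?X $$ (1, 2) \<noteq> 0"
  proof (rule ccontr)
    assume no: "\<not> ?thesis"
    have "N = 0\<^sub>m 2 1"
    proof (rule eq_matI)
      fix i j assume ij: "i < dim_row (0\<^sub>m 2 1 :: complex mat)" "j < dim_col (0\<^sub>m 2 1 :: complex mat)"
      then have "?X $$ (i, 2) = N $$ (i, 0)"
        using N \<open>m = 1\<close> \<open>r = 2\<close> by (auto simp: X)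
      then show "N $$ (i, j) = 0\<^sub>m 2 1 $$ (i, j)"
        using no ij by (auto simp: less_2_cases_iff)
    qed (use N \<open>m = 1\<close> \<open>r = 2\<close> in auto)
    then show False
      using rk \<open>m = 1\<close> \<open>r = 2\<close> vec_space.rank_0I[of 2 1, where 'a = complex] by simp
  qed
  have not_rank_1: False if "\<And>a b. a < 3 \<Longrightarrow> b < 3 \<Longrightarrow> ?X $$ (a, b) = u a * v b" for u v
  proof -
    have "vec_space.rank 3 (T * ?X * mat_adjoint T) \<le> 1"
      using that by (rule rank_mult_rank_one_le_1[OF T adj(2) Xc])
    then show False
      using \<open>m = 1\<close> M_eq by (simp add: m_def corank_def)
  qed
  show thesis
  proof
    show "\<exists>j < 2. ?X $$ (0, j) * ?X $$ (1, 2) \<noteq> ?X $$ (1, j) * ?X $$ (0, 2)"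
    proof (rule ccontr)
      assume "\<not> ?thesis"
      then have minor: "?X $$ (0, j) * ?X $$ (1, 2) = ?X $$ (1, j) * ?X $$ (0, 2)" if "j < 3" for j
        using that by (cases "j = 2") auto
      show False
      proof (cases "?X $$ (1, 2) = 0")
        case False
        define e where "e = ?X $$ (0, 2) / ?X $$ (1, 2)"
        have e: "?X $$ (0, j) = e * ?X $$ (1, j)" if "j < 3" for j
        proof -
          have "x = y / z * w" if "z \<noteq> 0" "x * z = w * y" for x y z w :: complex
            using that by (simp add: field_simps)
          then show ?thesis
            unfolding e_def using False minor[OF that] by blast
        qed
        show False
        proof (rule not_rank_1)
          fix a b :: nat assume "a < 3" "b < 3"
          moreover from \<open>a < 3\<close> consider "a = 0" | "a = 1" | "a = 2" by linarith
          ultimately show "?X $$ (a, b) = (if a = 0 then e else if a = 1 then 1 else 0) * ?X $$ (1, b)"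
            using e row2 by cases auto
        qed
      next
        case True
        then have "?X $$ (1, j) = 0" if "j < 3" for j
          using minor[OF that] last_col by simp
        note row1 = this
        show False
        proof (rule not_rank_1)
          fix a b :: nat assume "a < 3" "b < 3"
          moreover from \<open>a < 3\<close> consider "a = 0" | "a = 1" | "a = 2" by linarith
          ultimately show "?X $$ (a, b) = (if a = 0 then 1 else 0) * ?X $$ (0, b)"
            using row1 row2 by cases auto
        qed
      qed
    qed
  qed (use S row2 in auto)
qed

section \<open>Reduction of the differential\<close>

lemma in_span_triple:
  assumes "f = form_scale a x + form_scale b y + form_scale c z"
  shows "f \<in> form.span {x, y, z}"
  unfolding assms by (intro form.span_add form.span_scale form.span_base) auto

lemma adapted_basis_change_3:
  assumes \<tau>: "adapted_basis 3 br J \<tau> \<beta>"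
    and s: "s1 \<in> form.span {\<tau> 1, \<tau> 2, \<tau> 3}" "s2 \<in> form.span {\<tau> 1, \<tau> 2, \<tau> 3}"
      "s3 \<in> form.span {\<tau> 1, \<tau> 2, \<tau> 3}"
    and t: "\<tau> 1 \<in> form.span {s1, s2, s3}" "\<tau> 2 \<in> form.span {s1, s2, s3}"
      "\<tau> 3 \<in> form.span {s1, s2, s3}"
    and "c \<noteq> 0"
  obtains \<sigma> where "\<sigma> 1 = s1" "\<sigma> 2 = s2" "\<sigma> 3 = s3" "adapted_basis 3 br J \<sigma> (form_scale c \<beta>)"
proof
  define \<sigma> where "\<sigma> = \<tau>(1 := s1, 2 := s2, 3 := s3, 4 := form_scale c (\<tau> 4))"
  show \<sigma>: "\<sigma> 1 = s1" "\<sigma> 2 = s2" "\<sigma> 3 = s3"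
    by (simp_all add: \<sigma>_def)
  have set3: "{1..3} = {1, 2, 3 :: nat}" by auto
  show "adapted_basis 3 br J \<sigma> (form_scale c \<beta>)"
  proof (rule adapted_basis_change[OF \<tau>])
    show "\<sigma> (Suc 3) = form_scale c (\<tau> (Suc 3))"
      by (simp add: \<sigma>_def)
  next
    fix i :: nat assume "i \<in> {1..3}"
    then have "1 \<le> i" "i \<le> 3" by auto
    then consider "i = 1" | "i = 2" | "i = 3" by linarith
    then show "\<sigma> i \<in> form.span (\<tau> ` {1..3})" and "\<tau> i \<in> form.span (\<sigma> ` {1..3})"
      unfolding set3 image_insert image_empty \<sigma> using \<sigma> s t by (cases; simp only:)+
  qed fact
qed

definition has_normal_form ::
  "('a::real_vector \<Rightarrow> 'a \<Rightarrow> 'a) \<Rightarrow> ('a \<Rightarrow> 'a) \<Rightarrow> bool" where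
  "has_normal_form br J \<longleftrightarrow> (\<exists>\<sigma>.
     adapted_basis 3 br J \<sigma>
       (wedge (\<sigma> 1) (cnj_form (\<sigma> 2)) + wedge (\<sigma> 2) (cnj_form (\<sigma> 3))) \<or>
     adapted_basis 3 br J \<sigma>
       (wedge (\<sigma> 1) (cnj_form (\<sigma> 1)) + wedge (\<sigma> 2) (cnj_form (\<sigma> 3))))"

text \<open>If \<open>a = 0\<close>, rescaling \<open>\<tau>\<^sub>1\<close> is enough. Otherwise \<open>\<sigma>\<^sub>1 = \<tau>\<^sub>1 + (b/a) \<tau>\<^sub>2\<close> turns the first summand
  into a multiple of \<open>\<sigma>\<^sub>1 \<and> cnj \<sigma>\<^sub>1\<close> plus a multiple of \<open>\<tau>\<^sub>2 \<and> cnj \<sigma>\<^sub>1\<close>; the latter is absorbed into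
  the third form. Rescaling \<open>\<sigma>\<^sub>1\<close> multiplies \<open>\<sigma>\<^sub>1 \<and> cnj \<sigma>\<^sub>1\<close> by a positive real number only, so the
  complex factor has to be removed by rescaling the non-closed form.\<close>

lemma reduce_first_summand:
  assumes \<tau>: "adapted_basis 3 br J \<tau>
      (wedge (\<tau> 1) (cnj_form (form_scale a (\<tau> 1) + form_scale b (\<tau> 2))) +
       wedge (\<tau> 2) (cnj_form (\<tau> 3)))"
    and ab: "a \<noteq> 0 \<or> b \<noteq> 0"
  shows "has_normal_form br J"
proof (cases "a = 0")
  case True
  with ab have b: "b \<noteq> 0" by simp
  obtain \<sigma> where \<sigma>: "\<sigma> 1 = form_scale (cnj b) (\<tau> 1)" "\<sigma> 2 = \<tau> 2" "\<sigma> 3 = \<tau> 3"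
    and ad: "adapted_basis 3 br J \<sigma> (form_scale 1
      (wedge (\<tau> 1) (cnj_form (form_scale a (\<tau> 1) + form_scale b (\<tau> 2))) +
       wedge (\<tau> 2) (cnj_form (\<tau> 3))))"
  proof (rule adapted_basis_change_3[OF \<tau>, of "form_scale (cnj b) (\<tau> 1)" "\<tau> 2" "\<tau> 3" 1])
    show "\<tau> 1 \<in> form.span {form_scale (cnj b) (\<tau> 1), \<tau> 2, \<tau> 3}"
      using b by (intro in_span_triple[where a = "1 / cnj b" and b = 0 and c = 0])
        (simp add: form_scale_def fun_eq_iff)
  qed ((rule that; assumption) | force intro: form.span_base form.span_scale)+
  have "form_scale 1 (wedge (\<tau> 1) (cnj_form (form_scale a (\<tau> 1) + form_scale b (\<tau> 2))) +
       wedge (\<tau> 2) (cnj_form (\<tau> 3))) =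
      wedge (\<sigma> 1) (cnj_form (\<sigma> 2)) + wedge (\<sigma> 2) (cnj_form (\<sigma> 3))"
    unfolding \<sigma> using True
    by (auto simp: fun_eq_iff form_scale_def wedge_def cnj_form_def algebra_simps)
  with ad show ?thesis
    by (auto simp: has_normal_form_def)
next
  case a: False
  define s1 where "s1 = \<tau> 1 + form_scale (b / a) (\<tau> 2)"
  define s3 where "s3 = form_scale (1 / a) (\<tau> 3) + form_scale (- cnj b / cnj a) s1"
  obtain \<sigma> where \<sigma>: "\<sigma> 1 = s1" "\<sigma> 2 = \<tau> 2" "\<sigma> 3 = s3"
    and ad: "adapted_basis 3 br J \<sigma> (form_scale (1 / cnj a)
      (wedge (\<tau> 1) (cnj_form (form_scale a (\<tau> 1) + form_scale b (\<tau> 2))) +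
       wedge (\<tau> 2) (cnj_form (\<tau> 3))))"
  proof (rule adapted_basis_change_3[OF \<tau>, of s1 "\<tau> 2" s3 "1 / cnj a"])
    show s1: "s1 \<in> form.span {\<tau> 1, \<tau> 2, \<tau> 3}"
      unfolding s1_def by (intro form.span_add form.span_scale form.span_base) auto
    show "s3 \<in> form.span {\<tau> 1, \<tau> 2, \<tau> 3}"
      unfolding s3_def by (intro form.span_add form.span_scale s1) (auto intro: form.span_base)
    show "\<tau> 1 \<in> form.span {s1, \<tau> 2, s3}"
      by (rule in_span_triple[where a = 1 and b = "- b / a" and c = 0])
        (simp add: s1_def form_scale_def fun_eq_iff)
    show "\<tau> 3 \<in> form.span {s1, \<tau> 2, s3}"
      using a by (intro in_span_triple[where a = "a * cnj b / cnj a" and b = 0 and c = a])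
        (simp add: s3_def form_scale_def fun_eq_iff field_simps)
  qed ((rule that; assumption) | force intro: form.span_base simp: a)+
  have "form_scale (1 / cnj a)
      (wedge (\<tau> 1) (cnj_form (form_scale a (\<tau> 1) + form_scale b (\<tau> 2))) +
       wedge (\<tau> 2) (cnj_form (\<tau> 3))) =
      wedge (\<sigma> 1) (cnj_form (\<sigma> 1)) + wedge (\<sigma> 2) (cnj_form (\<sigma> 3))"
    unfolding \<sigma> s1_def s3_def using a
    by (auto simp: fun_eq_iff form_scale_def wedge_def cnj_form_def field_simps)
  with ad show ?thesis
    by (auto simp: has_normal_form_def)
qed

text \<open>Since \<open>n2\<close> is non-zero, the form \<open>s3\<close> next to \<open>\<tau>\<^sub>2\<close> completes \<open>\<tau>\<^sub>1\<close>, \<open>\<tau>\<^sub>2\<close> to a basis of the closed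
  forms. In this basis the form next to \<open>\<tau>\<^sub>1\<close> has the component \<open>e s3\<close> with \<open>e = n1 / n2\<close>, and
  \<open>\<tau>\<^sub>1 \<and> cnj (e s3)\<close> is merged with \<open>\<tau>\<^sub>2 \<and> cnj s3\<close>.\<close>

lemma reduce_two_summands_pivot:
  assumes \<tau>: "adapted_basis 3 br J \<tau>
      (wedge (\<tau> 1) (cnj_form (form_scale p (\<tau> 1) + form_scale q (\<tau> 2) + form_scale n1 (\<tau> 3))) +
       wedge (\<tau> 2) (cnj_form (form_scale r (\<tau> 1) + form_scale s (\<tau> 2) + form_scale n2 (\<tau> 3))))"
    (is "adapted_basis 3 br J \<tau> ?\<beta>")
    and minor: "p * n2 \<noteq> r * n1 \<or> q * n2 \<noteq> s * n1" and n2: "n2 \<noteq> 0"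
  shows "has_normal_form br J"
proof -
  define e a b where "e = n1 / n2" and "a = p - r * e" and "b = q - s * e"
  define s2 where "s2 = \<tau> 2 + form_scale (cnj e) (\<tau> 1)"
  define s3 where "s3 = form_scale r (\<tau> 1) + form_scale s (\<tau> 2) + form_scale n2 (\<tau> 3)"
  obtain \<sigma> where \<sigma>: "\<sigma> 1 = \<tau> 1" "\<sigma> 2 = s2" "\<sigma> 3 = s3"
    and ad: "adapted_basis 3 br J \<sigma> (form_scale 1 ?\<beta>)"
  proof (rule adapted_basis_change_3[OF \<tau>, of "\<tau> 1" s2 s3 1])
    show "s2 \<in> form.span {\<tau> 1, \<tau> 2, \<tau> 3}"
      unfolding s2_def by (intro form.span_add form.span_scale form.span_base) auto
    show "s3 \<in> form.span {\<tau> 1, \<tau> 2, \<tau> 3}"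
      by (rule in_span_triple) (simp add: s3_def)
    show "\<tau> 2 \<in> form.span {\<tau> 1, s2, s3}"
      by (rule in_span_triple[where a = "- cnj e" and b = 1 and c = 0])
        (simp add: s2_def form_scale_def fun_eq_iff)
    show "\<tau> 3 \<in> form.span {\<tau> 1, s2, s3}"
      using n2 by (intro in_span_triple[where a = "(s * cnj e - r) / n2" and b = "- s / n2"
            and c = "1 / n2"])
        (simp add: s2_def s3_def form_scale_def fun_eq_iff field_simps)
  qed ((rule that; assumption) | force intro: form.span_base)+
  have "form_scale 1 ?\<beta> =
      wedge (\<sigma> 1) (cnj_form (form_scale (a - b * cnj e) (\<sigma> 1) + form_scale b (\<sigma> 2))) +
      wedge (\<sigma> 2) (cnj_form (\<sigma> 3))"
  proof -
    have n1: "n1 = e * n2"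
      using n2 by (simp add: e_def)
    show ?thesis
      unfolding \<sigma> s2_def s3_def a_def b_def n1
      by (auto simp: fun_eq_iff form_scale_def wedge_def cnj_form_def algebra_simps)
  qed
  moreover have "a - b * cnj e \<noteq> 0 \<or> b \<noteq> 0"
  proof (rule ccontr)
    assume "\<not> ?thesis"
    then have "b = 0" and "a = 0" by auto
    then have "p = r * e" and "q = s * e" by (simp_all add: a_def b_def)
    with minor n2 show False
      by (simp add: e_def)
  qed
  ultimately show ?thesis
    using ad reduce_first_summand[of br J \<sigma>] by simp
qed

text \<open>The hypothesis on the minors forces \<open>n1\<close> or \<open>n2\<close> to be non-zero and is symmetric in the two
  summands, so that they may be exchanged if \<open>n2\<close> vanishes.\<close>

lemma reduce_two_summands:
  assumes \<tau>: "adapted_basis 3 br J \<tau>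
      (wedge (\<tau> 1) (cnj_form (form_scale p (\<tau> 1) + form_scale q (\<tau> 2) + form_scale n1 (\<tau> 3))) +
       wedge (\<tau> 2) (cnj_form (form_scale r (\<tau> 1) + form_scale s (\<tau> 2) + form_scale n2 (\<tau> 3))))"
    (is "adapted_basis 3 br J \<tau> ?\<beta>")
    and minor: "p * n2 \<noteq> r * n1 \<or> q * n2 \<noteq> s * n1"
  shows "has_normal_form br J"
proof (cases "n2 = 0")
  case False
  then show ?thesis
    using reduce_two_summands_pivot[OF \<tau> minor] by simp
next
  case True
  with minor have n1: "n1 \<noteq> 0" by auto
  obtain \<sigma> where \<sigma>: "\<sigma> 1 = \<tau> 2" "\<sigma> 2 = \<tau> 1" "\<sigma> 3 = \<tau> 3"
    and ad: "adapted_basis 3 br J \<sigma> (form_scale 1 ?\<beta>)"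
    by (rule adapted_basis_change_3[OF \<tau>, of "\<tau> 2" "\<tau> 1" "\<tau> 3" 1])
      ((rule that; assumption) | force intro: form.span_base)+
  have "form_scale 1 ?\<beta> =
      wedge (\<sigma> 1) (cnj_form (form_scale s (\<sigma> 1) + form_scale r (\<sigma> 2) + form_scale n2 (\<sigma> 3))) +
      wedge (\<sigma> 2) (cnj_form (form_scale q (\<sigma> 1) + form_scale p (\<sigma> 2) + form_scale n1 (\<sigma> 3)))"
    unfolding \<sigma> by (simp add: add_ac form.scale_one)
  then show ?thesis
    using ad minor n1 by (intro reduce_two_summands_pivot[of br J \<sigma> s r n2 q p n1]) auto
qed

theorem theorem4p24:
  fixes br :: "'a::real_vector \<Rightarrow> 'a \<Rightarrow> 'a"
    and J :: "'a \<Rightarrow> 'a"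
    and M :: "complex mat"
  assumes "real_vector.dim (UNIV :: 'a set) = 8"
    and "nilpotent_lie_algebra br"
    and "M \<in> carrier_mat 3 3"
    and "is_J_M 4 br J M"
    and "\<not> invertible_mat M"
    and "mat_adjoint M \<noteq> M"
    and "maximal_type 3 M"
  shows "\<exists>\<sigma>. basis10 4 J \<sigma> \<and>
    ce_d br (\<sigma> 1) = 0 \<and> ce_d br (\<sigma> 2) = 0 \<and> ce_d br (\<sigma> 3) = 0 \<and>
    (ce_d br (\<sigma> 4) = wedge (\<sigma> 1) (cnj_form (\<sigma> 2)) + wedge (\<sigma> 2) (cnj_form (\<sigma> 3)) \<or>
     ce_d br (\<sigma> 4) = wedge (\<sigma> 1) (cnj_form (\<sigma> 1)) + wedge (\<sigma> 2) (cnj_form (\<sigma> 3)))"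
proof -
  have four: "Suc 3 = 4" and set3: "{1..3} = {1, 2, 3 :: nat}"
    by auto
  obtain \<omega> where \<omega>: "adapted_basis 3 br J \<omega> (sesqui_form 3 M \<omega>)"
    using assms(4) by (auto simp: is_J_M_def adapted_basis_def sesqui_form_def)
  obtain S where S: "S \<in> carrier_mat 3 3" "invertible_mat S"
    and row2: "\<And>j. j < 3 \<Longrightarrow> (S * M * mat_adjoint S) $$ (2, j) = 0"
    and minor: "\<exists>j < 2. (S * M * mat_adjoint S) $$ (0, j) * (S * M * mat_adjoint S) $$ (1, 2) \<noteq>
           (S * M * mat_adjoint S) $$ (1, j) * (S * M * mat_adjoint S) $$ (0, 2)"
    using maximal_type_3_shape[OF assms(7)] by metis
  define X where "X = S * M * mat_adjoint S"
  obtain \<tau> where \<tau>: "adapted_basis 3 br J \<tau> (sesqui_form 3 X \<tau>)"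
    using adapted_basis_congruence[OF assms(3) S \<omega>] by (auto simp: X_def)
  have "sesqui_form 3 X \<tau> =
      wedge (\<tau> 1) (cnj_form (form_scale (cnj (X $$ (0, 0))) (\<tau> 1) +
        form_scale (cnj (X $$ (0, 1))) (\<tau> 2) + form_scale (cnj (X $$ (0, 2))) (\<tau> 3))) +
      wedge (\<tau> 2) (cnj_form (form_scale (cnj (X $$ (1, 0))) (\<tau> 1) +
        form_scale (cnj (X $$ (1, 1))) (\<tau> 2) + form_scale (cnj (X $$ (1, 2))) (\<tau> 3)))"
    unfolding sesqui_form_def set3 using row2[folded X_def]
    by (auto simp: fun_eq_iff form_scale_def wedge_def cnj_form_def
        algebra_simps)
  moreover have "cnj (X $$ (0, 0)) * cnj (X $$ (1, 2)) \<noteq> cnj (X $$ (1, 0)) * cnj (X $$ (0, 2)) \<or>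
      cnj (X $$ (0, 1)) * cnj (X $$ (1, 2)) \<noteq> cnj (X $$ (1, 1)) * cnj (X $$ (0, 2))"
    using minor[folded X_def] unfolding complex_cnj_mult[symmetric] complex_cnj_cancel_iff
    by (auto simp: less_2_cases_iff)
  ultimately have "has_normal_form br J"
    using \<tau> by (intro reduce_two_summands) auto
  then show ?thesis
    unfolding has_normal_form_def adapted_basis_def set3 four by blast
qed

end
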